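(* Let $(G,\mathcal{T})$ be a separable topological group metrized by a right-invariant metric, and let $\mathcal{D}_{\mathcal{B}}(\mathcal{T})$ be the topology on $G$ consisting of all subsets of $G$ that are $\mathcal{T}$-locally comeagre at all of their points. Then: (vi) (Haupt-Pauc property) $\mathcal{B}_0(\mathcal{D}_{\mathcal{B}}(\mathcal{T}))=\mathcal{B}_0(\mathcal{T})$ and $\mathcal{B}(\mathcal{D}_{\mathcal{B}}(\mathcal{T}))=\mathcal{B}(\mathcal{T})$; (vii) (Nikodym property) for all $t\in G$: (a) $tU\in\mathcal{B}(\mathcal{D}_{\mathcal{B}}(\mathcal{T}))$ for every $U\in\mathcal{B}(\mathcal{D}_{\mathcal{B}}(\mathcal{T}))$; and (b) $tU\in\mathcal{B}_0(\mathcal{D}_{\mathcal{B}}(\mathcal{T}))$ if and only if $U\in\mathcal{B}_0(\mathcal{D}_{\mathcal{B}}(\mathcal{T}))$.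
   Context: For a topology $\tau$ on $G$: $\mathcal{B}(\tau)$ is the family of sets with the Baire property in $\tau$ and $\mathcal{B}_0(\tau)$ is the family of $\tau$-meagre sets. A set $H\subseteq G$ is $\mathcal{T}$-locally comeagre at all of its points if for each $x\in H$ there is a $\mathcal{T}$-open neighbourhood $U$ of $x$ such that $U\setminus H$ is $\mathcal{T}$-meagre; the family of all such $H$ is a topology refining $\mathcal{T}$.
   Formalization: The equality of the meagre families in (vi) is stated only when G is not T-meagre in itself; it fails otherwise (e.g. the rationals, where the refined topology is discrete). All other claims are stated without this condition. *)

theory Defs
  imports "HOL-Analysis.Analysis" "HOL-Algebra.Coset"
begin

definition topological_group :: "('a, 'b) monoid_scheme \<Rightarrow> 'a topology \<Rightarrow> bool" where
  "topological_group G T \<longleftrightarrow>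
     group G \<and> topspace T = carrier G \<and>
     continuous_map (prod_topology T T) T (\<lambda>(x, y). x \<otimes>\<^bsub>G\<^esub> y) \<and>
     continuous_map T T (\<lambda>x. inv\<^bsub>G\<^esub> x)"

definition metrized_by_right_invariant ::
  "('a, 'b) monoid_scheme \<Rightarrow> 'a topology \<Rightarrow> ('a \<Rightarrow> 'a \<Rightarrow> real) \<Rightarrow> bool" where
  "metrized_by_right_invariant G T d \<longleftrightarrow>
     Metric_space (carrier G) d \<and>
     T = Metric_space.mtopology (carrier G) d \<and>
     (\<forall>x\<in>carrier G. \<forall>y\<in>carrier G. \<forall>g\<in>carrier G. d (x \<otimes>\<^bsub>G\<^esub> g) (y \<otimes>\<^bsub>G\<^esub> g) = d x y)"

definition nowhere_dense_in :: "'a topology \<Rightarrow> 'a set \<Rightarrow> bool" where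
  "nowhere_dense_in T A \<longleftrightarrow> A \<subseteq> topspace T \<and> T interior_of (T closure_of A) = {}"

definition meagre_in :: "'a topology \<Rightarrow> 'a set \<Rightarrow> bool" where
  "meagre_in T A \<longleftrightarrow> (\<exists>N :: nat \<Rightarrow> 'a set. (\<forall>n. nowhere_dense_in T (N n)) \<and> A = (\<Union>n. N n))"

definition meagre_sets :: "'a topology \<Rightarrow> 'a set set" where
  "meagre_sets T = {A. meagre_in T A}"

definition baire_property_sets :: "'a topology \<Rightarrow> 'a set set" where
  "baire_property_sets T =
     {A. A \<subseteq> topspace T \<and> (\<exists>U. openin T U \<and> meagre_in T ((A - U) \<union> (U - A)))}"

definition locally_comeagre :: "'a topology \<Rightarrow> 'a set \<Rightarrow> bool" where
  "locally_comeagre T H \<longleftrightarrow>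
     H \<subseteq> topspace T \<and> (\<forall>x\<in>H. \<exists>U. openin T U \<and> x \<in> U \<and> meagre_in T (U - H))"

(* If the whole space is T-meagre, then every subset is locally comeagre, so this topology is
   discrete and its only meagre set is the empty set.  Hence its meagre sets can only agree with
   the T-meagre ones when the space is not meagre in itself (counterexample: the rationals). *)
definition baire_density_topology :: "'a topology \<Rightarrow> 'a topology" where
  "baire_density_topology T = topology (locally_comeagre T)"

lemma nowhere_dense_in_subset:
  assumes "nowhere_dense_in T A" "B \<subseteq> A"
  shows "nowhere_dense_in T B"
  using assms closure_of_mono[of B A T] interior_of_mono[of "T closure_of B" "T closure_of A" T]
  unfolding nowhere_dense_in_def by blast

lemma meagre_in_subset:
  assumes "meagre_in T A" "B \<subseteq> A"
  shows "meagre_in T B"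
proof -
  obtain N :: "nat \<Rightarrow> 'a set" where N: "\<And>n. nowhere_dense_in T (N n)" "A = (\<Union>n. N n)"
    using assms(1) unfolding meagre_in_def by blast
  have "\<And>n. nowhere_dense_in T (N n \<inter> B)"
    using N(1) nowhere_dense_in_subset by (metis Int_lower1)
  moreover have "B = (\<Union>n. N n \<inter> B)"
    using N(2) assms(2) by blast
  ultimately show ?thesis
    unfolding meagre_in_def by (intro exI[of _ "\<lambda>n. N n \<inter> B"]) blast
qed

lemma meagre_in_Un:
  assumes "meagre_in T A" "meagre_in T B"
  shows "meagre_in T (A \<union> B)"
proof -
  obtain M :: "nat \<Rightarrow> 'a set" where M: "\<And>n. nowhere_dense_in T (M n)" "A = (\<Union>n. M n)"
    using assms(1) unfolding meagre_in_def by blast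
  obtain N :: "nat \<Rightarrow> 'a set" where N: "\<And>n. nowhere_dense_in T (N n)" "B = (\<Union>n. N n)"
    using assms(2) unfolding meagre_in_def by blast
  let ?P = "\<lambda>n. if even n then M (n div 2) else N (n div 2)"
  have "A \<union> B = (\<Union>n. ?P n)"
  proof
    show "A \<union> B \<subseteq> (\<Union>n. ?P n)"
    proof
      fix x assume "x \<in> A \<union> B"
      then consider n where "x \<in> M n" | n where "x \<in> N n"
        using M(2) N(2) by blast
      then show "x \<in> (\<Union>n. ?P n)"
      proof cases
        case (1 n)
        then have "x \<in> ?P (2 * n)" by simp
        then show ?thesis by blast
      next
        case (2 n)
        then have "x \<in> ?P (2 * n + 1)" by simp
        then show ?thesis by blast
      qed
    qed
  qed (use M(2) N(2) in \<open>auto split: if_splits\<close>)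
  moreover have "\<forall>n. nowhere_dense_in T (?P n)"
    using M(1) N(1) by simp
  ultimately show ?thesis
    unfolding meagre_in_def by (intro exI[of _ ?P] conjI)
qed

lemma istopology_locally_comeagre: "istopology (locally_comeagre T)"
  unfolding istopology_def
proof (intro conjI allI impI)
  fix H K assume H: "locally_comeagre T H" and K: "locally_comeagre T K"
  show "locally_comeagre T (H \<inter> K)"
    unfolding locally_comeagre_def
  proof (intro conjI ballI)
    show "H \<inter> K \<subseteq> topspace T"
      using H unfolding locally_comeagre_def by blast
    fix x assume x: "x \<in> H \<inter> K"
    obtain U where U: "openin T U" "x \<in> U" "meagre_in T (U - H)"
      using H x unfolding locally_comeagre_def by blast
    obtain V where V: "openin T V" "x \<in> V" "meagre_in T (V - K)"
      using K x unfolding locally_comeagre_def by blast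
    have "meagre_in T (U \<inter> V - H \<inter> K)"
      by (rule meagre_in_subset[OF meagre_in_Un[OF U(3) V(3)]]) blast
    then show "\<exists>W. openin T W \<and> x \<in> W \<and> meagre_in T (W - H \<inter> K)"
      using U V by (intro exI[of _ "U \<inter> V"]) auto
  qed
next
  fix \<K> assume \<K>: "\<forall>K\<in>\<K>. locally_comeagre T K"
  show "locally_comeagre T (\<Union>\<K>)"
    unfolding locally_comeagre_def
  proof (intro conjI ballI)
    show "\<Union>\<K> \<subseteq> topspace T"
      using \<K> unfolding locally_comeagre_def by blast
    fix x assume "x \<in> \<Union>\<K>"
    then obtain K where K: "K \<in> \<K>" "x \<in> K" by blast
    then obtain U where U: "openin T U" "x \<in> U" "meagre_in T (U - K)"
      using \<K> unfolding locally_comeagre_def by blast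
    have "meagre_in T (U - \<Union>\<K>)"
      by (rule meagre_in_subset[OF U(3)]) (use K in blast)
    then show "\<exists>U. openin T U \<and> x \<in> U \<and> meagre_in T (U - \<Union>\<K>)"
      using U by blast
  qed
qed

lemma openin_baire_density_topology:
  "openin (baire_density_topology T) H \<longleftrightarrow> locally_comeagre T H"
  by (simp add: baire_density_topology_def topology_inverse' istopology_locally_comeagre)

lemma meagre_in_empty: "meagre_in T {}"
  unfolding meagre_in_def nowhere_dense_in_def by (intro exI[of _ "\<lambda>_. {}"]) simp

lemma openin_imp_locally_comeagre:
  assumes "openin T U"
  shows "locally_comeagre T U"
  unfolding locally_comeagre_def
  using assms openin_subset[OF assms] meagre_in_empty[of T] by (metis Diff_cancel)

lemma topspace_baire_density_topology [simp]:
  "topspace (baire_density_topology T) = topspace T"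
proof
  show "topspace (baire_density_topology T) \<subseteq> topspace T"
    using openin_topspace[of "baire_density_topology T"]
    unfolding openin_baire_density_topology locally_comeagre_def by blast
  show "topspace T \<subseteq> topspace (baire_density_topology T)"
    by (intro openin_subset)
      (simp add: openin_baire_density_topology openin_imp_locally_comeagre)
qed

end

theory Submission
  imports Defs
begin

text \<open>
  In a second countable space a density-open set is an open set minus a meagre set, because the
  open sets witnessing local comeagreness can be taken from a countable base. Hence a
  density-nowhere dense set is meagre in the original topology. Conversely a meagre set is
  density-closed, and it has empty density interior as soon as no nonempty open set is meagre. A
  nonmeagre separable group has this last property, since countably many translates of a nonempty
  open set cover it; if the group is meagre, the density topology is discrete and every set has the
  Baire property in both topologies. The Nikodym property holds because translations are
  homeomorphisms of the density topology as well.
\<close>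

section \<open>Countable unions of meagre sets, and countable bases of separable metric
  spaces\<close>

lemma meagre_in_imp_subset_topspace:
  assumes "meagre_in X A"
  shows "A \<subseteq> topspace X"
  using assms unfolding meagre_in_def nowhere_dense_in_def by blast

text \<open>Countable families are easier to merge than sequences: a countable union of them is
  again countable, so no pairing of indices is required.\<close>

lemma meagre_in_iff_countable_Union:
  "meagre_in X A \<longleftrightarrow> (\<exists>\<C>. countable \<C> \<and> (\<forall>N\<in>\<C>. nowhere_dense_in X N) \<and> A = \<Union>\<C>)"
proof
  assume "meagre_in X A"
  then obtain N :: "nat \<Rightarrow> 'a set" where "\<forall>n. nowhere_dense_in X (N n)" "A = (\<Union>n. N n)"
    unfolding meagre_in_def by blast
  then show "\<exists>\<C>. countable \<C> \<and> (\<forall>N\<in>\<C>. nowhere_dense_in X N) \<and> A = \<Union>\<C>"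
    by (intro exI[of _ "range N"]) auto
next
  assume "\<exists>\<C>. countable \<C> \<and> (\<forall>N\<in>\<C>. nowhere_dense_in X N) \<and> A = \<Union>\<C>"
  then obtain \<C> where \<C>: "countable \<C>" "\<forall>N\<in>\<C>. nowhere_dense_in X N" "A = \<Union>\<C>"
    by blast
  \<comment> \<open>Inserting the nowhere dense set \<open>{}\<close> makes the family nonempty, so
    \<open>from_nat_into\<close> enumerates exactly its members even when \<C> is empty.\<close>
  have "range (from_nat_into (insert {} \<C>)) = insert {} \<C>"
    using \<C>(1) by (intro range_from_nat_into) auto
  moreover have "nowhere_dense_in X {}"
    by (simp add: nowhere_dense_in_def)
  ultimately have "\<forall>n. nowhere_dense_in X (from_nat_into (insert {} \<C>) n)"
    using \<C>(2) by (metis insertE rangeI)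
  moreover have "A = (\<Union>n. from_nat_into (insert {} \<C>) n)"
    using \<C>(3) \<open>range _ = _\<close> by simp
  ultimately show "meagre_in X A"
    unfolding meagre_in_def by blast
qed

lemma nowhere_dense_in_imp_meagre_in: "nowhere_dense_in X A \<Longrightarrow> meagre_in X A"
  unfolding meagre_in_iff_countable_Union by (intro exI[of _ "{A}"]) simp

lemma meagre_in_countable_Union:
  assumes "countable \<A>" and "\<And>A. A \<in> \<A> \<Longrightarrow> meagre_in X A"
  shows "meagre_in X (\<Union>\<A>)"
proof -
  obtain \<C> where \<C>: "\<And>A. A \<in> \<A> \<Longrightarrow> countable (\<C> A)"
      "\<And>A N. A \<in> \<A> \<Longrightarrow> N \<in> \<C> A \<Longrightarrow> nowhere_dense_in X N"
      "\<And>A. A \<in> \<A> \<Longrightarrow> \<Union>(\<C> A) = A"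
    using assms(2) unfolding meagre_in_iff_countable_Union by metis
  have "\<Union>(\<Union>A\<in>\<A>. \<C> A) = (\<Union>A\<in>\<A>. \<Union>(\<C> A))"
    by blast
  also have "\<dots> = \<Union>\<A>"
    using \<C>(3) by simp
  finally have "\<Union>\<A> = \<Union>(\<Union>A\<in>\<A>. \<C> A)" ..
  moreover have "countable (\<Union>A\<in>\<A>. \<C> A)"
    using assms(1) \<C>(1) by (rule countable_UN)
  moreover have "\<forall>N\<in>(\<Union>A\<in>\<A>. \<C> A). nowhere_dense_in X N"
    using \<C>(2) by blast
  ultimately show ?thesis
    unfolding meagre_in_iff_countable_Union by blast
qed

text \<open>The balls of radius 1/(n+1) about the points of a countable dense set form a countable
  base.\<close>

lemma (in Metric_space) separable_imp_second_countable:
  assumes "separable_space mtopology"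
  shows "second_countable mtopology"
proof -
  obtain C where C: "countable C" "C \<subseteq> M" "mtopology closure_of C = M"
    using assms unfolding separable_space_def by auto
  define \<B> where "\<B> = (\<lambda>(c, n). mball c (inverse (real (Suc n)))) ` (C \<times> (UNIV :: nat set))"
  have "\<exists>V\<in>\<B>. x \<in> V \<and> V \<subseteq> U" if U: "openin mtopology U" "x \<in> U" for U x
  proof -
    obtain r where r: "r > 0" "mball x r \<subseteq> U" and "x \<in> M"
      using U unfolding openin_mtopology by blast
    \<comment> \<open>Half of \<open>r\<close> is right because two radii add up: a centre
      \<open>c\<close> within \<open>?e\<close> of \<open>x\<close> has all points of its
      \<open>?e\<close>-ball within 2 \<open>?e\<close> < \<open>r\<close> of
      \<open>x\<close>.\<close>
    obtain n where n: "inverse (real (Suc n)) < r / 2"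
      using r(1) reals_Archimedean[of "r / 2"] by auto
    let ?e = "inverse (real (Suc n))"
    have "x \<in> mtopology closure_of C"
      using C(3) \<open>x \<in> M\<close> by simp
    then have "\<forall>r>0. \<exists>c\<in>C. c \<in> mball x r"
      unfolding metric_closure_of by simp
    moreover have "?e > 0"
      by simp
    ultimately obtain c where c: "c \<in> C" "d x c < ?e"
      using in_mball by blast
    have "x \<in> mball c ?e"
      using c C(2) \<open>x \<in> M\<close> commute by auto
    moreover have "mball c ?e \<subseteq> mball x r"
    proof
      fix y assume y: "y \<in> mball c ?e"
      then have "d x y \<le> d x c + d c y"
        using \<open>x \<in> M\<close> triangle by simp
      then show "y \<in> mball x r"
        using y c n \<open>x \<in> M\<close> by auto
    qed
    moreover have "mball c ?e \<in> \<B>"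
      using c(1) unfolding \<B>_def by force
    ultimately show ?thesis
      using r(2) by blast
  qed
  moreover have "countable \<B>" "\<forall>V\<in>\<B>. openin mtopology V"
    using C(1) by (auto simp: \<B>_def)
  ultimately show ?thesis
    unfolding second_countable_def by blast
qed

section \<open>Invariance under homeomorphisms, also for the density topology\<close>

lemma nowhere_dense_in_homeomorphic_image:
  assumes f: "homeomorphic_map X Y f" and N: "nowhere_dense_in X N"
  shows "nowhere_dense_in Y (f ` N)"
proof -
  have "N \<subseteq> topspace X" and int: "X interior_of (X closure_of N) = {}"
    using N unfolding nowhere_dense_in_def by blast+
  then have "Y interior_of (Y closure_of (f ` N)) = f ` (X interior_of (X closure_of N))"
    by (simp add: homeomorphic_map_closure_of[OF f] homeomorphic_map_interior_of[OF f]
        closure_of_subset_topspace)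
  then show ?thesis
    using int \<open>N \<subseteq> topspace X\<close> homeomorphic_imp_surjective_map[OF f]
    unfolding nowhere_dense_in_def by blast
qed

lemma meagre_in_homeomorphic_image:
  assumes f: "homeomorphic_map X Y f" and A: "meagre_in X A"
  shows "meagre_in Y (f ` A)"
proof -
  obtain N :: "nat \<Rightarrow> 'a set" where N: "\<And>n. nowhere_dense_in X (N n)" "A = (\<Union>n. N n)"
    using A unfolding meagre_in_def by blast
  then show ?thesis
    using nowhere_dense_in_homeomorphic_image[OF f]
    unfolding meagre_in_def by (intro exI[of _ "\<lambda>n. f ` N n"]) blast
qed

lemma meagre_in_homeomorphic_image_iff:
  assumes f: "homeomorphic_map X Y f" and A: "A \<subseteq> topspace X"
  shows "meagre_in Y (f ` A) \<longleftrightarrow> meagre_in X A"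
proof
  obtain g where "homeomorphic_maps X Y f g"
    using f homeomorphic_map_maps by blast
  then have g: "homeomorphic_map Y X g" "\<And>x. x \<in> topspace X \<Longrightarrow> g (f x) = x"
    unfolding homeomorphic_maps_map by blast+
  assume "meagre_in Y (f ` A)"
  then have "meagre_in X (g ` f ` A)"
    by (rule meagre_in_homeomorphic_image[OF g(1)])
  \<comment> \<open>The inverse \<open>g\<close> undoes \<open>f\<close> only on the topspace, which
    is where \<open>A\<close> is assumed to lie.\<close>
  moreover have "g ` f ` A = A"
    using g(2) A by force
  ultimately show "meagre_in X A"
    by simp
qed (rule meagre_in_homeomorphic_image[OF f])

lemma baire_property_homeomorphic_image:
  assumes f: "homeomorphic_map X Y f" and A: "A \<in> baire_property_sets X"
  shows "f ` A \<in> baire_property_sets Y"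
proof -
  obtain U where U: "openin X U" "meagre_in X ((A - U) \<union> (U - A))" and "A \<subseteq> topspace X"
    using A unfolding baire_property_sets_def by blast
  have "U \<subseteq> topspace X"
    using U(1) by (rule openin_subset)
  \<comment> \<open>Images commute with set difference here since \<open>f\<close> is injective on
    the topspace, which contains both sets.\<close>
  have "f ` A - f ` U \<union> (f ` U - f ` A) = f ` ((A - U) \<union> (U - A))"
    using homeomorphic_imp_injective_map[OF f] \<open>A \<subseteq> topspace X\<close> \<open>U \<subseteq> topspace X\<close>
    unfolding inj_on_def by blast
  then have "meagre_in Y (f ` A - f ` U \<union> (f ` U - f ` A))"
    using meagre_in_homeomorphic_image[OF f U(2)] by simp
  moreover have "openin Y (f ` U)"
    using homeomorphic_map_openness[OF f \<open>U \<subseteq> topspace X\<close>] U(1) by simp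
  moreover have "f ` A \<subseteq> topspace Y"
    using homeomorphic_imp_surjective_map[OF f] \<open>A \<subseteq> topspace X\<close> by blast
  ultimately show ?thesis
    unfolding baire_property_sets_def by blast
qed

text \<open>Local comeagreness is pulled back along \<open>f\<close> by taking preimages of the open
  witnesses. Continuity alone would not do, since a continuous preimage of a meagre set can fail to
  be meagre; the inverse homeomorphism \<open>g\<close> carries the exceptional set
  \<open>U - H\<close> to a meagre set covering the new exceptional set.\<close>

lemma continuous_map_baire_density_topology:
  assumes "homeomorphic_maps X Y f g"
  shows "continuous_map (baire_density_topology X) (baire_density_topology Y) f"
  unfolding continuous_map_alt openin_baire_density_topology topspace_baire_density_topology
proof (intro conjI allI impI)
  have cont: "continuous_map X Y f" and g: "homeomorphic_map Y X g"
    and gf: "\<And>x. x \<in> topspace X \<Longrightarrow> g (f x) = x"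
    using assms homeomorphic_maps_map unfolding homeomorphic_maps_def by blast+
  show "f \<in> topspace X \<rightarrow> topspace Y"
    using cont by (rule continuous_map_funspace)
  fix H assume H: "locally_comeagre Y H"
  show "locally_comeagre X (f -` H \<inter> topspace X)"
    unfolding locally_comeagre_def
  proof (intro conjI ballI)
    fix x assume x: "x \<in> f -` H \<inter> topspace X"
    then obtain U where U: "openin Y U" "f x \<in> U" "meagre_in Y (U - H)"
      using H unfolding locally_comeagre_def by blast
    have "f -` U \<inter> topspace X - f -` H \<inter> topspace X \<subseteq> g ` (U - H)"
      using gf by force
    then have "meagre_in X (f -` U \<inter> topspace X - f -` H \<inter> topspace X)"
      by (rule meagre_in_subset[OF meagre_in_homeomorphic_image[OF g U(3)]])
    moreover have "openin X (f -` U \<inter> topspace X)"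
      using cont U(1) unfolding continuous_map_alt by blast
    ultimately show "\<exists>V. openin X V \<and> x \<in> V \<and> meagre_in X (V - f -` H \<inter> topspace X)"
      using U(2) x by (intro exI[of _ "f -` U \<inter> topspace X"]) blast
  qed blast
qed

lemma homeomorphic_map_baire_density_topology:
  assumes "homeomorphic_map X Y f"
  shows "homeomorphic_map (baire_density_topology X) (baire_density_topology Y) f"
proof -
  obtain g where fg: "homeomorphic_maps X Y f g"
    using assms homeomorphic_map_maps by blast
  then have gf: "homeomorphic_maps Y X g f"
    using homeomorphic_maps_sym by blast
  have "homeomorphic_maps (baire_density_topology X) (baire_density_topology Y) f g"
    using fg continuous_map_baire_density_topology[OF fg] continuous_map_baire_density_topology[OF gf]
    by (simp add: homeomorphic_maps_def)
  then show ?thesis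
    using homeomorphic_map_maps by blast
qed

section \<open>Comparison of the meagre sets of the two topologies\<close>

lemma locally_comeagre_imp_open_minus_meagre:
  assumes X: "second_countable X" and H: "locally_comeagre X H"
  obtains W where "openin X W" "H \<subseteq> W" "meagre_in X (W - H)"
proof -
  obtain \<B> where \<B>: "countable \<B>" "\<forall>V\<in>\<B>. openin X V"
    "\<And>U x. openin X U \<Longrightarrow> x \<in> U \<Longrightarrow> \<exists>V\<in>\<B>. x \<in> V \<and> V \<subseteq> U"
    using X unfolding second_countable_def by metis
  \<comment> \<open>Any base set inside a witness of local comeagreness is itself a witness, so \<V>
    covers \<open>H\<close>. As \<V> is countable, the meagre sets \<open>V - H\<close> have a
    meagre union.\<close>
  define \<V> where "\<V> = {V \<in> \<B>. meagre_in X (V - H)}"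
  show thesis
  proof
    show "openin X (\<Union>\<V>)"
      using \<B>(2) by (auto simp: \<V>_def)
    show "H \<subseteq> \<Union>\<V>"
    proof
      fix x assume "x \<in> H"
      then obtain U where U: "openin X U" "x \<in> U" "meagre_in X (U - H)"
        using H unfolding locally_comeagre_def by blast
      then obtain V where "V \<in> \<B>" "x \<in> V" "V \<subseteq> U"
        using \<B>(3) by blast
      then show "x \<in> \<Union>\<V>"
        using meagre_in_subset[OF U(3), of "V - H"] unfolding \<V>_def by blast
    qed
    have "meagre_in X (\<Union>((\<lambda>V. V - H) ` \<V>))"
      using \<B>(1) by (intro meagre_in_countable_Union) (auto simp: \<V>_def)
    then show "meagre_in X (\<Union>\<V> - H)"
      by (rule meagre_in_subset) blast
  qed
qed

text \<open>The complement \<open>H\<close> of the density closure \<open>K\<close> of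
  \<open>N\<close> is an open set \<open>W\<close> minus a meagre set. The remaining closed set
  \<open>topspace X - W\<close> lies in \<open>K\<close>; its interior is also density-open, hence
  empty. So \<open>K\<close> is covered by a nowhere dense set and the meagre set
  \<open>W - H\<close>.\<close>

lemma nowhere_dense_in_baire_density_imp_meagre:
  assumes X: "second_countable X" and N: "nowhere_dense_in (baire_density_topology X) N"
  shows "meagre_in X N"
proof -
  let ?D = "baire_density_topology X"
  define K where "K = ?D closure_of N"
  define H where "H = topspace X - K"
  have "N \<subseteq> topspace ?D" and int: "?D interior_of K = {}"
    using N by (simp_all add: nowhere_dense_in_def K_def)
  then have "N \<subseteq> K"
    by (simp add: K_def closure_of_subset)
  have "K \<subseteq> topspace X"
    using closure_of_subset_topspace[of ?D N] by (simp add: K_def)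
  have "openin ?D H"
    using closedin_closure_of[of ?D N] unfolding H_def K_def closedin_def by simp
  then have "locally_comeagre X H"
    by (simp add: openin_baire_density_topology)
  then obtain W where W: "openin X W" "H \<subseteq> W" "meagre_in X (W - H)"
    by (rule locally_comeagre_imp_open_minus_meagre[OF X])
  have "X interior_of (topspace X - W) = {}"
  proof -
    have "openin ?D (X interior_of (topspace X - W))"
      by (simp add: openin_baire_density_topology openin_imp_locally_comeagre)
    moreover have "X interior_of (topspace X - W) \<subseteq> K"
      using interior_of_subset[of X "topspace X - W"] W(2) unfolding H_def by blast
    ultimately show ?thesis
      using int interior_of_maximal by blast
  qed
  then have "nowhere_dense_in X (topspace X - W)"
    using W(1) unfolding nowhere_dense_in_def by (simp add: closure_of_closedin closedin_diff)
  then have "meagre_in X ((topspace X - W) \<union> (W - H))"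
    using W(3) by (rule meagre_in_Un[OF nowhere_dense_in_imp_meagre_in])
  then show ?thesis
    by (rule meagre_in_subset) (use \<open>N \<subseteq> K\<close> \<open>K \<subseteq> topspace X\<close> H_def in blast)
qed

lemma meagre_in_baire_density_imp_meagre:
  assumes X: "second_countable X" and A: "meagre_in (baire_density_topology X) A"
  shows "meagre_in X A"
proof -
  obtain \<C> where "countable \<C>" "\<forall>N\<in>\<C>. nowhere_dense_in (baire_density_topology X) N" "A = \<Union>\<C>"
    using A unfolding meagre_in_iff_countable_Union by blast
  then show ?thesis
    using nowhere_dense_in_baire_density_imp_meagre[OF X] meagre_in_countable_Union by blast
qed

text \<open>A single density-nowhere dense set suffices, namely \<open>A\<close> itself. The whole
  space witnesses local comeagreness of its complement, so \<open>A\<close> is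
  density-closed.\<close>

lemma meagre_imp_meagre_in_baire_density:
  assumes X: "\<And>U. openin X U \<Longrightarrow> U \<noteq> {} \<Longrightarrow> \<not> meagre_in X U" and A: "meagre_in X A"
  shows "meagre_in (baire_density_topology X) A"
proof (rule nowhere_dense_in_imp_meagre_in)
  let ?D = "baire_density_topology X"
  have "A \<subseteq> topspace X"
    using A by (rule meagre_in_imp_subset_topspace)
  have "locally_comeagre X (topspace X - A)"
    unfolding locally_comeagre_def
  proof (intro conjI ballI)
    fix x assume "x \<in> topspace X - A"
    moreover have "meagre_in X (topspace X - (topspace X - A))"
      by (rule meagre_in_subset[OF A]) blast
    ultimately show "\<exists>U. openin X U \<and> x \<in> U \<and> meagre_in X (U - (topspace X - A))"
      by (intro exI[of _ "topspace X"]) simp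
  qed blast
  then have "closedin ?D A"
    using \<open>A \<subseteq> topspace X\<close> by (simp add: closedin_def openin_baire_density_topology)
  moreover have "?D interior_of A = {}"
  proof (rule ccontr)
    assume "?D interior_of A \<noteq> {}"
    then obtain x where x: "x \<in> ?D interior_of A"
      by blast
    have "locally_comeagre X (?D interior_of A)"
      using openin_interior_of[of ?D A] unfolding openin_baire_density_topology .
    then obtain U where U: "openin X U" "x \<in> U" "meagre_in X (U - ?D interior_of A)"
      using x unfolding locally_comeagre_def by blast
    \<comment> \<open>\<open>U\<close> is covered by \<open>A\<close> and the part of
      \<open>U\<close> outside the density interior of \<open>A\<close>, both meagre; this
      contradicts the assumption on nonempty open sets.\<close>
    have "meagre_in X U"
      by (rule meagre_in_subset[OF meagre_in_Un[OF U(3) A]])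
        (use interior_of_subset[of ?D A] in blast)
    then show False
      using X U(1,2) by blast
  qed
  ultimately show "nowhere_dense_in ?D A"
    using \<open>A \<subseteq> topspace X\<close> unfolding nowhere_dense_in_def by (simp add: closure_of_closedin)
qed

section \<open>Translations and nonmeagre open sets in a separable group\<close>

lemma homeomorphic_map_left_translation:
  assumes G: "topological_group G T" and t: "t \<in> carrier G"
  shows "homeomorphic_map T T (\<lambda>x. t \<otimes>\<^bsub>G\<^esub> x)"
proof -
  interpret group G
    using G unfolding topological_group_def by blast
  have top: "topspace T = carrier G"
    and mult: "continuous_map (prod_topology T T) T (\<lambda>(x, y). x \<otimes>\<^bsub>G\<^esub> y)"
    using G unfolding topological_group_def by blast+
  have cont: "continuous_map T T (\<lambda>x. s \<otimes>\<^bsub>G\<^esub> x)" if "s \<in> carrier G" for s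
  proof -
    have "continuous_map T (prod_topology T T) (\<lambda>x. (s, x))"
      using that top by (simp add: continuous_map_pairwise o_def)
    from continuous_map_compose[OF this mult] show ?thesis
      by (simp add: o_def)
  qed
  have "homeomorphic_maps T T (\<lambda>x. t \<otimes>\<^bsub>G\<^esub> x) (\<lambda>x. inv\<^bsub>G\<^esub> t \<otimes>\<^bsub>G\<^esub> x)"
    using t cont top unfolding homeomorphic_maps_def by (simp add: m_assoc[symmetric])
  then show ?thesis
    using homeomorphic_map_maps by blast
qed

text \<open>The translates of \<open>U\<close> by a countable dense set \<open>C\<close> cover the
  group. If \<open>U\<close> were meagre, each translate would be too, and so would the
  group.\<close>

lemma openin_nonmeagre_in_separable_group:
  assumes G: "topological_group G T" and sep: "separable_space T"
    and nonmeagre: "\<not> meagre_in T (carrier G)" and U: "openin T U" "U \<noteq> {}"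
  shows "\<not> meagre_in T U"
proof
  assume meagre: "meagre_in T U"
  interpret group G
    using G unfolding topological_group_def by blast
  have top: "topspace T = carrier G" and inv: "continuous_map T T (\<lambda>x. inv\<^bsub>G\<^esub> x)"
    using G unfolding topological_group_def by blast+
  obtain C where C: "countable C" "C \<subseteq> carrier G" "T closure_of C = topspace T"
    using sep top unfolding separable_space_def by auto
  have "U \<subseteq> carrier G"
    using openin_subset[OF U(1)] top by simp
  have "meagre_in T (\<Union>((\<lambda>c. (\<lambda>x. c \<otimes>\<^bsub>G\<^esub> x) ` U) ` C))"
  proof (rule meagre_in_countable_Union)
    fix A assume "A \<in> (\<lambda>c. (\<lambda>x. c \<otimes>\<^bsub>G\<^esub> x) ` U) ` C"
    then obtain c where c: "c \<in> carrier G" "A = (\<lambda>x. c \<otimes>\<^bsub>G\<^esub> x) ` U"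
      using C(2) by blast
    then show "meagre_in T A"
      using meagre_in_homeomorphic_image[OF homeomorphic_map_left_translation[OF G] meagre] by simp
  qed (use C(1) in blast)
  moreover have "carrier G \<subseteq> \<Union>((\<lambda>c. (\<lambda>x. c \<otimes>\<^bsub>G\<^esub> x) ` U) ` C)"
  proof
    fix g assume g: "g \<in> carrier G"
    \<comment> \<open>These are the elements \<open>x\<close> whose translate of \<open>U\<close>
      contains \<open>g\<close>. The set is open by continuity and contains g u^{-1} for each
      \<open>u\<close> in \<open>U\<close>, so it meets the dense set \<open>C\<close>.\<close>
    let ?V = "{x \<in> topspace T. inv\<^bsub>G\<^esub> x \<otimes>\<^bsub>G\<^esub> g \<in> U}"
    have "continuous_map T T (\<lambda>x. inv\<^bsub>G\<^esub> x \<otimes>\<^bsub>G\<^esub> g)"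
    proof -
      have "continuous_map T (prod_topology T T) (\<lambda>x. (inv\<^bsub>G\<^esub> x, g))"
        using g top inv by (simp add: continuous_map_pairwise o_def)
      moreover have "continuous_map (prod_topology T T) T (\<lambda>(x, y). x \<otimes>\<^bsub>G\<^esub> y)"
        using G unfolding topological_group_def by blast
      ultimately show ?thesis
        using continuous_map_compose by (fastforce simp: o_def)
    qed
    then have "openin T ?V"
      using U(1) by (rule openin_continuous_map_preimage)
    moreover have "?V \<noteq> {}"
    proof -
      obtain u where u: "u \<in> U" "u \<in> carrier G"
        using U(2) \<open>U \<subseteq> carrier G\<close> by blast
      then have "inv\<^bsub>G\<^esub> (g \<otimes>\<^bsub>G\<^esub> inv\<^bsub>G\<^esub> u) \<otimes>\<^bsub>G\<^esub> g = u"
        using g by (simp add: inv_mult_group m_assoc)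
      then have "g \<otimes>\<^bsub>G\<^esub> inv\<^bsub>G\<^esub> u \<in> ?V"
        using u g top by simp
      then show ?thesis
        by blast
    qed
    ultimately obtain c where c: "c \<in> C" "inv\<^bsub>G\<^esub> c \<otimes>\<^bsub>G\<^esub> g \<in> U"
      using C(3) unfolding dense_intersects_open by blast
    then have "g = c \<otimes>\<^bsub>G\<^esub> (inv\<^bsub>G\<^esub> c \<otimes>\<^bsub>G\<^esub> g)"
      using g C(2) by (simp add: m_assoc[symmetric] subset_iff)
    then show "g \<in> \<Union>((\<lambda>c. (\<lambda>x. c \<otimes>\<^bsub>G\<^esub> x) ` U) ` C)"
      using c by blast
  qed
  ultimately show False
    using nonmeagre meagre_in_subset by blast
qed

section \<open>The Baire property in both topologies, and the Haupt-Pauc and Nikodym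
  properties\<close>

lemma baire_property_baire_density_subset:
  assumes X: "second_countable X"
  shows "baire_property_sets (baire_density_topology X) \<subseteq> baire_property_sets X"
proof
  fix A assume "A \<in> baire_property_sets (baire_density_topology X)"
  then obtain H where "A \<subseteq> topspace X" and H: "locally_comeagre X H"
    and AH: "meagre_in X ((A - H) \<union> (H - A))"
    using meagre_in_baire_density_imp_meagre[OF X]
    unfolding baire_property_sets_def openin_baire_density_topology
      topspace_baire_density_topology by blast
  obtain W where W: "openin X W" "H \<subseteq> W" "meagre_in X (W - H)"
    using locally_comeagre_imp_open_minus_meagre[OF X H] .
  \<comment> \<open>Passing from \<open>H\<close> to the larger open set \<open>W\<close> enlarges
    the symmetric difference with \<open>A\<close> by at most the meagre set
    \<open>W - H\<close>.\<close>
  have "meagre_in X ((A - W) \<union> (W - A))"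
    by (rule meagre_in_subset[OF meagre_in_Un[OF AH W(3)]]) (use W(2) in blast)
  then show "A \<in> baire_property_sets X"
    using \<open>A \<subseteq> topspace X\<close> W(1) unfolding baire_property_sets_def by blast
qed

text \<open>The two alternatives exhaust the separable topological groups. In a meagre space every
  subset is density-open, so \<open>A\<close> is its own witness with empty difference. Otherwise
  the open witness remains density-open and the meagre difference remains meagre.\<close>

lemma baire_property_subset_baire_density:
  assumes "meagre_in X (topspace X) \<or> (\<forall>U. openin X U \<longrightarrow> U \<noteq> {} \<longrightarrow> \<not> meagre_in X U)"
  shows "baire_property_sets X \<subseteq> baire_property_sets (baire_density_topology X)"
proof
  fix A assume A: "A \<in> baire_property_sets X"
  then have "A \<subseteq> topspace X"
    unfolding baire_property_sets_def by blast
  have "\<exists>H. locally_comeagre X H \<and> meagre_in (baire_density_topology X) ((A - H) \<union> (H - A))"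
    using assms
  proof
    assume meagre: "meagre_in X (topspace X)"
    have "locally_comeagre X A"
      unfolding locally_comeagre_def
      using \<open>A \<subseteq> topspace X\<close> meagre_in_subset[OF meagre, of "topspace X - A"] by blast
    then show ?thesis
      using meagre_in_empty by (intro exI[of _ A]) simp
  next
    assume "\<forall>U. openin X U \<longrightarrow> U \<noteq> {} \<longrightarrow> \<not> meagre_in X U"
    then show ?thesis
      using A meagre_imp_meagre_in_baire_density[of X] openin_imp_locally_comeagre
      unfolding baire_property_sets_def by blast
  qed
  then show "A \<in> baire_property_sets (baire_density_topology X)"
    using \<open>A \<subseteq> topspace X\<close>
    unfolding baire_property_sets_def openin_baire_density_topology by simp
qed

text \<open>In the meagre equivalence, \<open>U\<close> is kept inside \<open>carrier G\<close>
  because multiplication is unspecified elsewhere; a set with the Baire property lies in the carrier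
  by definition.\<close>

theorem theorem2:
  fixes G :: "('a, 'b) monoid_scheme"
    and T :: "'a topology"
    and d :: "'a \<Rightarrow> 'a \<Rightarrow> real"
  assumes "topological_group G T"
    and "separable_space T"
    and "metrized_by_right_invariant G T d"
  shows "(\<not> meagre_in T (carrier G) \<longrightarrow>
           meagre_sets (baire_density_topology T) = meagre_sets T) \<and>
         baire_property_sets (baire_density_topology T) = baire_property_sets T \<and>
         (\<forall>t\<in>carrier G.
           (\<forall>U\<in>baire_property_sets (baire_density_topology T).
              t <#\<^bsub>G\<^esub> U \<in> baire_property_sets (baire_density_topology T)) \<and>
           (\<forall>U. U \<subseteq> carrier G \<longrightarrow>
              (t <#\<^bsub>G\<^esub> U \<in> meagre_sets (baire_density_topology T) \<longleftrightarrow>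
               U \<in> meagre_sets (baire_density_topology T))))"
proof -
  let ?D = "baire_density_topology T"
  have top: "topspace T = carrier G"
    using assms(1) unfolding topological_group_def by blast
  have sc: "second_countable T"
    using assms(2,3) Metric_space.separable_imp_second_countable
    unfolding metrized_by_right_invariant_def by blast
  have nonmeagre: "\<not> meagre_in T U"
    if "\<not> meagre_in T (carrier G)" "openin T U" "U \<noteq> {}" for U
    using openin_nonmeagre_in_separable_group[OF assms(1,2) that] .
  have "meagre_sets ?D = meagre_sets T" if "\<not> meagre_in T (carrier G)"
    using meagre_in_baire_density_imp_meagre[OF sc]
      meagre_imp_meagre_in_baire_density[OF nonmeagre[OF that]]
    unfolding meagre_sets_def by blast
  moreover have "baire_property_sets ?D = baire_property_sets T"
  proof
    show "baire_property_sets ?D \<subseteq> baire_property_sets T"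
      by (rule baire_property_baire_density_subset[OF sc])
    show "baire_property_sets T \<subseteq> baire_property_sets ?D"
      using nonmeagre top by (intro baire_property_subset_baire_density) auto
  qed
  moreover have "(\<forall>U\<in>baire_property_sets ?D. t <#\<^bsub>G\<^esub> U \<in> baire_property_sets ?D) \<and>
      (\<forall>U. U \<subseteq> carrier G \<longrightarrow> (t <#\<^bsub>G\<^esub> U \<in> meagre_sets ?D \<longleftrightarrow> U \<in> meagre_sets ?D))"
    if t: "t \<in> carrier G" for t
  proof -
    \<comment> \<open>Invariance is applied within the density topology rather than transferred from
      \<open>T\<close>, so both Nikodym clauses also cover groups that are meagre in themselves,
      where the meagre sets of the two topologies differ.\<close>
    have hom: "homeomorphic_map ?D ?D (\<lambda>x. t \<otimes>\<^bsub>G\<^esub> x)"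
      using homeomorphic_map_left_translation[OF assms(1) t]
      by (rule homeomorphic_map_baire_density_topology)
    have coset: "t <#\<^bsub>G\<^esub> U = (\<lambda>x. t \<otimes>\<^bsub>G\<^esub> x) ` U" for U
      unfolding l_coset_def by blast
    show ?thesis
      unfolding coset meagre_sets_def mem_Collect_eq
      using baire_property_homeomorphic_image[OF hom] meagre_in_homeomorphic_image_iff[OF hom] top
      by simp
  qed
  ultimately show ?thesis
    by blast
qed

end
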